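(* The limit $\lim_{k\to\infty} \log(\xi'_m(k))/k$ exists.
   Context: All graphs are finite and simple. For a bipartite graph $G$ with bipartition $V = A \sqcup B$ and positive integers $k_A, k_B$, $G$ is $(k_A,k_B)$-choosable if for every set of colors $C$ and every list assignment $L$ assigning to each vertex of $A$ a $k_A$-element subset of $C$ and to each vertex of $B$ a $k_B$-element subset of $C$, there is a map $c\colon V\to C$ with $c(v)\in L(v)$ for all $v$ and $c(v)\neq c(v')$ for every edge $vv'$. For the complete bipartite graph $K_{\Delta_B,\Delta_A}$ the part $A$ has $\Delta_B$ vertices and the part $B$ has $\Delta_A$ vertices. $\log$ is the natural logarithm. For a positive integer $k$, $\xi'_m(k)$ is the infimum of $\Delta_B(\log\Delta_A)^{k}/k_B^{k}$ over all positive integers $\Delta_A,\Delta_B,k_B$ such that $K_{\Delta_B,\Delta_A}$ is not $(k,k_B)$-choosable. *)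

theory Defs
  imports Complex_Main
begin

text \<open>
  A finite simple bipartite graph is given by its two parts and its set of edges, the edges being
  two-element sets of vertices.
\<close>

locale bipartite_graph =
  fixes A B :: "'v set" and E :: "'v set set"
  assumes finite_parts: "finite A" "finite B"
    and disjoint_parts: "A \<inter> B = {}"
    and edges: "E \<subseteq> {{a, b} | a b. a \<in> A \<and> b \<in> B}"

definition list_assignment ::
  "'v set \<Rightarrow> 'v set \<Rightarrow> nat \<Rightarrow> nat \<Rightarrow> 'c set \<Rightarrow> ('v \<Rightarrow> 'c set) \<Rightarrow> bool" where
  "list_assignment A B kA kB C L \<longleftrightarrow>
     (\<forall>v\<in>A. L v \<subseteq> C \<and> card (L v) = kA) \<and> (\<forall>v\<in>B. L v \<subseteq> C \<and> card (L v) = kB)"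

definition list_colouring ::
  "'v set \<Rightarrow> 'v set \<Rightarrow> 'v set set \<Rightarrow> ('v \<Rightarrow> 'c set) \<Rightarrow> ('v \<Rightarrow> 'c) \<Rightarrow> bool" where
  "list_colouring A B E L c \<longleftrightarrow>
     (\<forall>v \<in> A \<union> B. c v \<in> L v) \<and> (\<forall>v v'. {v, v'} \<in> E \<longrightarrow> c v \<noteq> c v')"

text \<open>
  A definition cannot quantify over the type of colours, so the sets of colours range over all
  subsets of \<^typ>\<open>nat\<close>. For finite graphs and positive list sizes only finitely many colours
  occur, and colours of any other type are covered as well; see \<open>choosable_any_colours\<close>.
\<close>

definition choosable :: "'v set \<Rightarrow> 'v set \<Rightarrow> 'v set set \<Rightarrow> nat \<Rightarrow> nat \<Rightarrow> bool" where
  "choosable A B E kA kB \<longleftrightarrow>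
     (\<forall>(C :: nat set) L. list_assignment A B kA kB C L \<longrightarrow> (\<exists>c. list_colouring A B E L c))"

lemma (in bipartite_graph) choosable_any_colours:
  fixes C :: "'c set" and L :: "'v \<Rightarrow> 'c set"
  assumes ch: "choosable A B E kA kB" and pos: "kA > 0" "kB > 0"
    and L: "list_assignment A B kA kB C L"
  shows "\<exists>c. list_colouring A B E L c"
proof -
  let ?U = "\<Union>v\<in>A \<union> B. L v"
  have fin: "finite (L v)" if "v \<in> A \<union> B" for v
    using that L pos by (auto simp: list_assignment_def intro: card_ge_0_finite)
  then have "finite ?U"
    using finite_parts by blast
  then obtain f :: "'c \<Rightarrow> nat" where f: "inj_on f ?U"
    using finite_imp_inj_to_nat_seg by blast
  have sub: "L v \<subseteq> ?U" if "v \<in> A \<union> B" for v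
    using that by blast
  have card: "card (f ` L v) = card (L v)" if "v \<in> A \<union> B" for v
    using inj_on_subset[OF f sub[OF that]] by (rule card_image)
  have "list_assignment A B kA kB UNIV (\<lambda>v. f ` L v)"
    using L card by (auto simp: list_assignment_def)
  then obtain c where c: "list_colouring A B E (\<lambda>v. f ` L v) c"
    using ch unfolding choosable_def by blast
  define d where "d v = (SOME x. x \<in> L v \<and> f x = c v)" for v
  have d: "d v \<in> L v \<and> f (d v) = c v" if "v \<in> A \<union> B" for v
  proof -
    have "\<exists>x. x \<in> L v \<and> f x = c v"
      using c that unfolding list_colouring_def by fastforce
    then show ?thesis
      unfolding d_def by (rule someI_ex)
  qed
  have "d v \<noteq> d v'" if "{v, v'} \<in> E" for v v'
  proof -
    have "v \<in> A \<union> B" "v' \<in> A \<union> B"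
      using that edges by (auto simp: doubleton_eq_iff)
    moreover have "c v \<noteq> c v'"
      using c that unfolding list_colouring_def by blast
    ultimately show ?thesis
      using d by metis
  qed
  then show ?thesis
    using d unfolding list_colouring_def by blast
qed

definition K_left :: "nat \<Rightarrow> (nat + nat) set" where
  "K_left m = Inl ` {..<m}"

definition K_right :: "nat \<Rightarrow> (nat + nat) set" where
  "K_right n = Inr ` {..<n}"

definition K_edges :: "nat \<Rightarrow> nat \<Rightarrow> (nat + nat) set set" where
  "K_edges m n = {{a, b} | a b. a \<in> K_left m \<and> b \<in> K_right n}"

lemma bipartite_graph_complete: "bipartite_graph (K_left m) (K_right n) (K_edges m n)"
  by unfold_locales (auto simp: K_left_def K_right_def K_edges_def)

abbreviation K_choosable :: "nat \<Rightarrow> nat \<Rightarrow> nat \<Rightarrow> nat \<Rightarrow> bool" where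
  "K_choosable m n kA kB \<equiv> choosable (K_left m) (K_right n) (K_edges m n) kA kB"

text \<open>
  \<open>xi_m' k\<close> is used for \<open>k \<ge> 1\<close> only. The set is bounded below by 0. Note that
  \<open>xi_m' 1 = 0\<close>, because \<open>\<Delta>A = 1\<close>, \<open>\<Delta>B = kB\<close> is then admissible, whereas
  \<open>xi_m' k > 0\<close> for \<open>k \<ge> 2\<close>, so that the convention \<open>ln 0 = 0\<close> plays no role in the limit.
\<close>

definition xi_m' :: "nat \<Rightarrow> real" where
  "xi_m' k = Inf {real \<Delta>B * ln (real \<Delta>A) ^ k / real kB ^ k | \<Delta>A \<Delta>B kB.
     \<Delta>A > 0 \<and> \<Delta>B > 0 \<and> kB > 0 \<and> \<not> K_choosable \<Delta>B \<Delta>A k kB}"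

end

theory Submission
  imports Defs "HOL-Library.FuncSet" "HOL-Real_Asymp.Real_Asymp"
begin

text \<open>
  Bad list assignments of complete bipartite graphs are pairs of set families \<open>F\<close>, \<open>G\<close> such that
  every transversal of \<open>F\<close> contains a member of \<open>G\<close>. Taking unions \<open>e\<^sub>1 \<union> e\<^sub>2\<close> of members of two
  such \<open>F\<close>'s on disjoint colour sets adds the values of \<open>k\<close>, multiplies the sizes of the \<open>F\<close>'s and
  adds the sizes of the \<open>G\<close>'s. Hence \<open>xi_m'\<close> would be submultiplicative if both factors had the
  same large \<open>ln (card G)\<close>. Blow-ups equalise the list sizes; taking \<open>s\<close> disjoint copies multiplies
  \<open>ln (card G)\<close> by \<open>s\<close> at the cost of a factor \<open>s\<close> only. So repeatedly doubling a nearly optimal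
  pair for \<open>k\<close> gives \<open>limsup ln (xi_m' n) / n \<le> ln (xi_m' k) / k + ln (256 * k) / k\<close> for each \<open>k \<ge> 2\<close>.
  The values \<open>ln (xi_m' n) / n\<close> are bounded below because a random set of colours separates small families.
\<close>

section \<open>Blocking systems and independence of the colour type\<close>

text \<open>\<open>F\<close> collects the lists on the left and \<open>G\<close> those on the right.
  Finiteness is required beside the cardinality because \<open>card\<close> is 0 on infinite sets
  and \<open>k = 0\<close> occurs as the start of inductions.\<close>

definition blocking_system :: "'c set set \<Rightarrow> 'c set set \<Rightarrow> nat \<Rightarrow> nat \<Rightarrow> bool" where
  "blocking_system F G k b \<longleftrightarrow> finite F \<and> finite G \<and>
     (\<forall>e\<in>F. finite e \<and> card e = k) \<and> (\<forall>f\<in>G. finite f \<and> card f = b) \<and>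
     (\<forall>S. (\<forall>e\<in>F. e \<inter> S \<noteq> {}) \<longrightarrow> (\<exists>f\<in>G. f \<subseteq> S))"

text \<open>The inequalities leave room for repeated lists and make crude size estimates sufficient.
  Colours are natural numbers only because a definition cannot quantify over types.\<close>

definition blocked :: "nat \<Rightarrow> nat \<Rightarrow> nat \<Rightarrow> nat \<Rightarrow> bool" where
  "blocked k m n b \<longleftrightarrow>
     (\<exists>F G :: nat set set. blocking_system F G k b \<and> card F \<le> m \<and> card G \<le> n)"

lemma blocking_systemI:
  assumes "finite F" "finite G"
    and "\<And>e. e \<in> F \<Longrightarrow> finite e \<and> card e = k" "\<And>f. f \<in> G \<Longrightarrow> finite f \<and> card f = b"
    and "\<And>S. \<forall>e\<in>F. e \<inter> S \<noteq> {} \<Longrightarrow> \<exists>f\<in>G. f \<subseteq> S"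
  shows "blocking_system F G k b"
  using assms unfolding blocking_system_def by simp

text \<open>Only finitely many colours occur, so they embed into the natural numbers. The
  constructions below can therefore use sums and products as colour types.\<close>

lemma blockedI:
  fixes F G :: "'c set set"
  assumes sys: "blocking_system F G k b" and "card F \<le> m" "card G \<le> n"
  shows "blocked k m n b"
proof -
  let ?U = "\<Union>F \<union> \<Union>G"
  have fin: "finite F" "finite G" and cF: "\<And>e. e \<in> F \<Longrightarrow> finite e \<and> card e = k"
    and cG: "\<And>e. e \<in> G \<Longrightarrow> finite e \<and> card e = b"
    and bl: "\<And>S. (\<forall>e\<in>F. e \<inter> S \<noteq> {}) \<Longrightarrow> (\<exists>f\<in>G. f \<subseteq> S)"
    using sys unfolding blocking_system_def by simp_all
  have "finite ?U"
    using fin cF cG by (intro finite_UnI finite_Union) simp_all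
  then obtain \<phi> :: "'c \<Rightarrow> nat" where \<phi>: "inj_on \<phi> ?U"
    using finite_imp_inj_to_nat_seg by metis
  have card: "card (\<phi> ` e) = card e" if "e \<subseteq> ?U" for e
    using inj_on_subset[OF \<phi> that] by (rule card_image)
  have "\<exists>f\<in>(`) \<phi> ` G. f \<subseteq> S" if "\<forall>e\<in>(`) \<phi> ` F. e \<inter> S \<noteq> {}" for S
  proof -
    have "\<forall>e\<in>F. e \<inter> \<phi> -` S \<noteq> {}"
    proof
      fix e assume "e \<in> F"
      then have "\<phi> ` e \<inter> S \<noteq> {}"
        using that by simp
      then show "e \<inter> \<phi> -` S \<noteq> {}"
        by auto
    qed
    from bl[OF this] obtain f where "f \<in> G" "f \<subseteq> \<phi> -` S"
      by (rule bexE)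
    then show ?thesis
      by (intro bexI[of _ "\<phi> ` f"]) auto
  qed
  moreover have "card (\<phi> ` e) = k" if "e \<in> F" for e
    using that cF by (subst card) auto
  moreover have "card (\<phi> ` e) = b" if "e \<in> G" for e
    using that cG by (subst card) auto
  ultimately have "blocking_system ((`) \<phi> ` F) ((`) \<phi> ` G) k b"
    using fin cF cG unfolding blocking_system_def by simp
  moreover have "card ((`) \<phi> ` F) \<le> m" "card ((`) \<phi> ` G) \<le> n"
    using card_image_le[OF fin(1), of "(`) \<phi>"] card_image_le[OF fin(2), of "(`) \<phi>"] assms
    by auto
  ultimately show ?thesis
    unfolding blocked_def by blast
qed

lemma blockedE:
  assumes "blocked k m n b"
  obtains F G :: "nat set set"
  where "blocking_system F G k b" "card F \<le> m" "card G \<le> n"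
  using assms unfolding blocked_def by (elim exE conjE)

lemma blocking_systemD:
  assumes "blocking_system F G k b"
  shows "finite F" "finite G"
    "\<And>e. e \<in> F \<Longrightarrow> finite e" "\<And>e. e \<in> F \<Longrightarrow> card e = k"
    "\<And>f. f \<in> G \<Longrightarrow> finite f" "\<And>f. f \<in> G \<Longrightarrow> card f = b"
    "\<And>S. (\<And>e. e \<in> F \<Longrightarrow> e \<inter> S \<noteq> {}) \<Longrightarrow> \<exists>f\<in>G. f \<subseteq> S"
  using assms unfolding blocking_system_def by simp_all

section \<open>Trivial systems, products, copies and blow-ups\<close>

text \<open>No set meets the empty list, so the blocking condition is vacuous.\<close>

lemma blocked_0: "blocked 0 1 n b"
  by (rule blockedI[of "{{}}" "{}"]) (auto simp: blocking_system_def)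

lemma blocked_1: "blocked 1 b 1 b"
proof (rule blockedI)
  show "blocking_system ((\<lambda>x. {x}) ` {..<b}) {{..<b}} 1 b"
    unfolding blocking_system_def by (simp add: subset_iff)
  show "card ((\<lambda>x. {x}) ` {..<b}) \<le> b"
    using card_image_le[of "{..<b}" "\<lambda>x. {x}"] by simp
qed simp

text \<open>If \<open>S\<close> contains no member of \<open>G1\<close> on the left summand and none
  of \<open>G2\<close> on the right one, then some \<open>e1\<close> and some \<open>e2\<close>
  avoid \<open>S\<close>, and so does their disjoint union.\<close>

lemma blocked_add:
  assumes 1: "blocked k1 m1 n1 b" and 2: "blocked k2 m2 n2 b"
  shows "blocked (k1 + k2) (m1 * m2) (n1 + n2) b"
proof -
  obtain F1 G1 :: "nat set set" where sys1: "blocking_system F1 G1 k1 b"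
    and card1: "card F1 \<le> m1" "card G1 \<le> n1"
    by (rule blockedE[OF 1])
  note F1 = blocking_systemD[OF sys1] card1
  obtain F2 G2 :: "nat set set" where sys2: "blocking_system F2 G2 k2 b"
    and card2: "card F2 \<le> m2" "card G2 \<le> n2"
    by (rule blockedE[OF 2])
  note F2 = blocking_systemD[OF sys2] card2
  let ?F = "(\<lambda>(e1, e2). e1 <+> e2) ` (F1 \<times> F2)"
  let ?G = "(`) Inl ` G1 \<union> (`) Inr ` G2"
  have bl: "\<exists>f\<in>?G. f \<subseteq> S" if S: "\<forall>e\<in>?F. e \<inter> S \<noteq> {}" for S
  proof (rule ccontr)
    assume no: "\<not> ?thesis"
    have "\<not> (\<exists>f\<in>G1. f \<subseteq> Inl -` S)" "\<not> (\<exists>f\<in>G2. f \<subseteq> Inr -` S)"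
      using no unfolding image_subset_iff_subset_vimage[symmetric] by (metis UnI1 UnI2 imageI)+
    then obtain e1 e2 where e1: "e1 \<in> F1" "e1 \<inter> Inl -` S = {}"
      and e2: "e2 \<in> F2" "e2 \<inter> Inr -` S = {}"
      using F1(7)[of "Inl -` S"] F2(7)[of "Inr -` S"] by meson
    have "e1 <+> e2 \<in> ?F"
      using e1(1) e2(1) by (intro image_eqI[of _ _ "(e1, e2)"]) auto
    then have "(e1 <+> e2) \<inter> S \<noteq> {}"
      by (rule bspec[OF S])
    then show False
      using e1(2) e2(2) by blast
  qed
  have sys: "blocking_system ?F ?G (k1 + k2) b"
  proof (rule blocking_systemI[OF _ _ _ _ bl])
    fix e assume "e \<in> ?F"
    then show "finite e \<and> card e = k1 + k2"
      using F1(3,4) F2(3,4) by (auto simp: card_Plus)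
  next
    fix f assume "f \<in> ?G"
    then show "finite f \<and> card f = b"
      using F1(5,6) F2(5,6) by (auto simp: card_image)
  qed (use F1(1,2) F2(1,2) in auto)
  have "card ?F \<le> card (F1 \<times> F2)"
    using F1(1) F2(1) by (intro card_image_le) auto
  also have "\<dots> \<le> m1 * m2"
    using F1(8) F2(8) by (simp add: card_cartesian_product mult_mono)
  finally have F: "card ?F \<le> m1 * m2" .
  have "card ?G \<le> card ((`) Inl ` G1 :: (nat + nat) set set) + card ((`) Inr ` G2 :: (nat + nat) set set)"
    by (rule card_Un_le)
  also have "\<dots> \<le> card G1 + card G2"
    using F1(2) F2(2) by (intro add_mono card_image_le)
  also have "\<dots> \<le> n1 + n2"
    using F1(9) F2(9) by simp
  finally show ?thesis
    by (rule blockedI[OF sys F])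
qed

text \<open>A transversal of all copies contains a member of \<open>G\<close> in each copy. The new
  right lists are the unions of one member per copy, encoded by choice functions
  \<open>h\<close>.\<close>

lemma blocked_copies:
  assumes "blocked k m n b"
  shows "blocked k (s * m) (n ^ s) (s * b)"
proof -
  obtain F G :: "nat set set" where sys: "blocking_system F G k b"
    and card: "card F \<le> m" "card G \<le> n"
    by (rule blockedE[OF assms])
  note F = blocking_systemD[OF sys] card
  let ?F = "(\<lambda>(i, e). Pair i ` e) ` ({..<s} \<times> F)"
  let ?G = "Sigma {..<s} ` ({..<s} \<rightarrow>\<^sub>E G)"
  have bl: "\<exists>f\<in>?G. f \<subseteq> S" if S: "\<forall>e\<in>?F. e \<inter> S \<noteq> {}" for S
  proof -
    have "\<exists>f\<in>G. f \<subseteq> Pair i -` S" if "i < s" for i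
    proof (rule F(7))
      fix e assume "e \<in> F"
      then have "Pair i ` e \<inter> S \<noteq> {}"
        using S that by auto
      then show "e \<inter> Pair i -` S \<noteq> {}"
        by blast
    qed
    then obtain h where h: "\<And>i. i < s \<Longrightarrow> h i \<in> G \<and> h i \<subseteq> Pair i -` S"
      by metis
    have "restrict h {..<s} \<in> {..<s} \<rightarrow>\<^sub>E G"
      using h by auto
    moreover have "Sigma {..<s} (restrict h {..<s}) \<subseteq> S"
      using h by fastforce
    ultimately show ?thesis
      by blast
  qed
  have cG: "finite (Sigma {..<s} h) \<and> card (Sigma {..<s} h) = s * b" if "h \<in> {..<s} \<rightarrow>\<^sub>E G" for h
  proof -
    have "finite (h i)" "card (h i) = b" if "i < s" for i
      using F(5,6) PiE_mem[OF \<open>h \<in> _\<close>] that by auto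
    then show ?thesis
      by auto
  qed
  have sys: "blocking_system ?F ?G k (s * b)"
  proof (rule blocking_systemI[OF _ _ _ _ bl])
    fix e assume "e \<in> ?F"
    then show "finite e \<and> card e = k"
      using F(3,4) by (auto simp: card_image inj_on_def)
  qed (use F(1,2) cG in \<open>auto intro!: finite_PiE\<close>)
  have "card ?F \<le> card ({..<s} \<times> F)"
    using F(1) by (intro card_image_le) auto
  also have "\<dots> \<le> s * m"
    using F(8) by (simp add: card_cartesian_product)
  finally have cF: "card ?F \<le> s * m" .
  have "card ?G \<le> card ({..<s} \<rightarrow>\<^sub>E G)"
    using F(2) by (intro card_image_le finite_PiE) auto
  also have "\<dots> \<le> n ^ s"
    using F(9) by (simp add: card_PiE power_mono)
  finally show ?thesis
    by (rule blockedI[OF sys cF])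
qed

text \<open>Each colour becomes a fibre of \<open>t\<close> colours. Right lists become unions of
  full fibres, left lists are replaced by all their \<open>t ^ k\<close> lifts. The colours with
  fibre inside \<open>S\<close> form a transversal of \<open>F\<close>: if \<open>e\<close> missed
  them, choosing a point outside \<open>S\<close> in each fibre over \<open>e\<close> would give a
  lift that misses \<open>S\<close>.\<close>

lemma blocked_blowup:
  assumes "blocked k m n b"
  shows "blocked k (t ^ k * m) n (t * b)"
proof -
  obtain F G :: "nat set set" where sys: "blocking_system F G k b"
    and card: "card F \<le> m" "card G \<le> n"
    by (rule blockedE[OF assms])
  note F = blocking_systemD[OF sys] card
  let ?I = "Sigma F (\<lambda>e. e \<rightarrow>\<^sub>E {..<t})"
  let ?F = "(\<lambda>(e, p). (\<lambda>x. (x, p x)) ` e) ` ?I"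
  let ?G = "(\<lambda>f. f \<times> {..<t}) ` G"
  have finI: "finite ?I"
    using F(1,3) by (auto intro!: finite_PiE)
  have bl: "\<exists>f\<in>?G. f \<subseteq> S" if S: "\<forall>e\<in>?F. e \<inter> S \<noteq> {}" for S
  proof -
    let ?T = "{x. \<forall>i<t. (x, i) \<in> S}"
    have "\<exists>f\<in>G. f \<subseteq> ?T"
    proof (rule F(7))
      fix e assume e: "e \<in> F"
      show "e \<inter> ?T \<noteq> {}"
      proof
        assume "e \<inter> ?T = {}"
        then have "\<forall>x\<in>e. \<exists>i<t. (x, i) \<notin> S"
          by auto
        then obtain p where p: "\<And>x. x \<in> e \<Longrightarrow> p x < t \<and> (x, p x) \<notin> S"
          by metis
        have "restrict p e \<in> e \<rightarrow>\<^sub>E {..<t}"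
          using p by auto
        then have "(\<lambda>x. (x, restrict p e x)) ` e \<in> ?F"
          using e by (intro image_eqI[of _ _ "(e, restrict p e)"]) auto
        then have "(\<lambda>x. (x, restrict p e x)) ` e \<inter> S \<noteq> {}"
          by (rule bspec[OF S])
        then show False
          using p by auto
      qed
    qed
    then show ?thesis
      by auto
  qed
  have sys: "blocking_system ?F ?G k (t * b)"
  proof (rule blocking_systemI[OF _ _ _ _ bl])
    fix e assume "e \<in> ?F"
    then show "finite e \<and> card e = k"
      using F(3,4) by (auto simp: card_image inj_on_def)
  qed (use F(2,5,6) finI in \<open>auto simp: card_cartesian_product\<close>)
  have "card ?F \<le> card ?I"
    using finI by (rule card_image_le)
  also have "\<dots> = (\<Sum>e\<in>F. card (e \<rightarrow>\<^sub>E {..<t}))"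
    using F(1,3) by (intro card_SigmaI) (auto intro!: finite_PiE)
  also have "\<dots> = (\<Sum>e\<in>F. t ^ k)"
    using F(3,4) by (intro sum.cong) (auto simp: card_PiE)
  also have "\<dots> \<le> t ^ k * m"
    using F(8) by simp
  finally have cF: "card ?F \<le> t ^ k * m" .
  have "card ?G \<le> n"
    using card_image_le[OF F(2), of "\<lambda>f. f \<times> {..<t}"] F(9) by simp
  then show ?thesis
    by (rule blockedI[OF sys cF])
qed

section \<open>Blocking systems as bad list assignments\<close>

lemma enumerate_with_repetitions:
  assumes "finite F" "F \<noteq> {}" "card F \<le> m"
  obtains e :: "nat \<Rightarrow> 'a" where "e ` {..<m} = F"
proof -
  obtain h where h: "bij_betw h {0..<card F} F"
    using ex_bij_betw_nat_finite[OF assms(1)] by blast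
  have c: "card F > 0"
    using assms by (simp add: card_gt_0_iff)
  have "(\<lambda>i. h (if i < card F then i else 0)) ` {..<m} = F"
  proof
    show "(\<lambda>i. h (if i < card F then i else 0)) ` {..<m} \<subseteq> F"
      using h c by (auto simp: bij_betw_def)
    show "F \<subseteq> (\<lambda>i. h (if i < card F then i else 0)) ` {..<m}"
    proof
      fix x assume "x \<in> F"
      then have "x \<in> h ` {0..<card F}"
        using h by (simp add: bij_betw_def)
      then obtain i where "i < card F" "x = h i"
        by auto
      then show "x \<in> (\<lambda>i. h (if i < card F then i else 0)) ` {..<m}"
        using assms(3) by (intro image_eqI[of _ _ i]) auto
    qed
  qed
  then show ?thesis
    using that by blast
qed

text \<open>Without left lists the empty set is a transversal, and it contains no list of positive
  size.\<close>

lemma blocked_pos: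
  assumes "blocked k m n b" "b > 0"
  shows "m > 0"
proof (rule ccontr)
  assume "\<not> m > 0"
  obtain F G :: "nat set set" where sys: "blocking_system F G k b"
    and card: "card F \<le> m" "card G \<le> n"
    by (rule blockedE[OF assms(1)])
  note F = blocking_systemD[OF sys] card
  have "F = {}"
    using F(1,8) \<open>\<not> m > 0\<close> by simp
  then show False
    using F(7)[of "{}"] F(6)[of "{}"] assms(2) by auto
qed

text \<open>A set \<open>S\<close> that meets all left lists and contains no right list yields a
  colouring: colours in \<open>S\<close> on the left, outside \<open>S\<close> on the right.
  Conversely, the colours used on the left form a transversal, so they exhaust some right list and
  clash with the colour chosen from it.\<close>

lemma not_K_choosable_iff_blocked:
  assumes k: "k > 0" and b: "b > 0"
  shows "\<not> K_choosable m n k b \<longleftrightarrow> blocked k m n b"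
proof
  assume "\<not> K_choosable m n k b"
  then obtain C and L :: "nat + nat \<Rightarrow> nat set"
    where L: "list_assignment (K_left m) (K_right n) k b C L"
      and nc: "\<not> (\<exists>c. list_colouring (K_left m) (K_right n) (K_edges m n) L c)"
    unfolding choosable_def by blast
  have fin: "finite (L v)" if "v \<in> K_left m \<union> K_right n" for v
    using L k b that by (auto simp: list_assignment_def intro: card_ge_0_finite)
  have bl: "\<exists>f\<in>L ` K_right n. f \<subseteq> S" if S: "\<forall>e\<in>L ` K_left m. e \<inter> S \<noteq> {}" for S
  proof (rule ccontr)
    assume no: "\<not> ?thesis"
    define T where "T v = (if v \<in> K_left m then L v \<inter> S else L v - S)" for v
    define c where "c v = (SOME x. x \<in> T v)" for v
    have "T v \<noteq> {}" if "v \<in> K_left m \<union> K_right n" for v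
      using S no that unfolding T_def by auto
    then have c: "c v \<in> T v" if "v \<in> K_left m \<union> K_right n" for v
      unfolding c_def using that by (simp add: some_in_eq)
    have left: "c v \<in> L v \<inter> S" if "v \<in> K_left m" for v
      using c[of v] that by (auto simp: T_def)
    have right: "c v \<in> L v - S" if "v \<in> K_right n" for v
      using c[of v] that by (auto simp: T_def K_left_def K_right_def split: if_splits)
    have "list_colouring (K_left m) (K_right n) (K_edges m n) L c"
      unfolding list_colouring_def K_edges_def
    proof (intro conjI ballI allI impI)
      fix v v' assume "{v, v'} \<in> {{a, b} |a b. a \<in> K_left m \<and> b \<in> K_right n}"
      then have "v \<in> K_left m \<and> v' \<in> K_right n \<or> v' \<in> K_left m \<and> v \<in> K_right n"
        by (auto simp: doubleton_eq_iff)
      then show "c v \<noteq> c v'"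
        using left right by force
    qed (use left right in blast)
    then show False
      using nc by blast
  qed
  have sys: "blocking_system (L ` K_left m) (L ` K_right n) k b"
    using L fin by (intro blocking_systemI bl)
      (auto simp: list_assignment_def K_left_def K_right_def)
  have "card (L ` K_left m) \<le> m"
    using card_image_le[of "{..<m}" "L \<circ> Inl"] by (simp add: K_left_def image_image comp_def)
  moreover have "card (L ` K_right n) \<le> n"
    using card_image_le[of "{..<n}" "L \<circ> Inr"] by (simp add: K_right_def image_image comp_def)
  ultimately show "blocked k m n b"
    by (rule blockedI[OF sys])
next
  assume *: "blocked k m n b"
  obtain F G :: "nat set set" where sys: "blocking_system F G k b"
    and card: "card F \<le> m" "card G \<le> n"
    by (rule blockedE[OF *])
  note F = blocking_systemD[OF sys] card
  \<comment> \<open>The enumerations need nonempty families. The empty set is not a transversal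
    because \<open>b > 0\<close>; the whole colour set is one because \<open>k > 0\<close>.\<close>
  have "F \<noteq> {}"
    using F(7)[of "{}"] F(6)[of "{}"] b by auto
  then obtain e where e: "e ` {..<m} = F"
    using enumerate_with_repetitions F(1,8) by metis
  have "G \<noteq> {}"
    using F(7)[of UNIV] F(4)[of "{}"] k by auto
  then obtain f where f: "f ` {..<n} = G"
    using enumerate_with_repetitions F(2,9) by metis
  let ?L = "case_sum e f"
  have "list_assignment (K_left m) (K_right n) k b UNIV ?L"
    using e f F(4,6) by (auto simp: list_assignment_def K_left_def K_right_def)
  moreover have "\<not> list_colouring (K_left m) (K_right n) (K_edges m n) ?L c" for c
  proof
    assume c: "list_colouring (K_left m) (K_right n) (K_edges m n) ?L c"
    have cl: "c (Inl i) \<in> e i" if "i < m" for i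
      using c that unfolding list_colouring_def K_left_def by force
    have "\<exists>f\<in>G. f \<subseteq> (c \<circ> Inl) ` {..<m}"
    proof (rule F(7))
      fix d assume "d \<in> F"
      then show "d \<inter> (c \<circ> Inl) ` {..<m} \<noteq> {}"
        using e cl by force
    qed
    then obtain j where j: "j < n" "f j \<subseteq> (c \<circ> Inl) ` {..<m}"
      using f by auto
    then have "c (Inr j) \<in> f j"
      using c unfolding list_colouring_def K_right_def by force
    then obtain i where i: "i < m" "c (Inr j) = c (Inl i)"
      using j by auto
    have "{Inl i, Inr j} \<in> K_edges m n"
      using i j unfolding K_edges_def K_left_def K_right_def by blast
    then show False
      using c i unfolding list_colouring_def by metis
  qed
  ultimately show "\<not> K_choosable m n k b"
    unfolding choosable_def by blast
qed

section \<open>The probabilistic lower bound\<close>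

text \<open>Left lists with at least two colours still meet the complement of a point
  \<open>x\<close>. Taking \<open>x\<close> in one right list forces a second right list that avoids
  \<open>x\<close>.\<close>

lemma blocked_imp_two_le:
  assumes "blocked k m n b" "k \<ge> 2" "b > 0"
  shows "n \<ge> 2"
proof (rule ccontr)
  assume n: "\<not> n \<ge> 2"
  obtain F G :: "nat set set" where sys: "blocking_system F G k b"
    and card: "card F \<le> m" "card G \<le> n"
    by (rule blockedE[OF assms(1)])
  note F = blocking_systemD[OF sys] card
  have "\<exists>f\<in>G. f \<subseteq> UNIV"
    using F(4)[of "{}"] assms(2) by (intro F(7)) auto
  then obtain f where f: "f \<in> G"
    by blast
  then obtain x where x: "x \<in> f"
    using F(6)[OF f] assms(3) by fastforce
  have "\<exists>f\<in>G. f \<subseteq> - {x}"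
  proof (rule F(7))
    fix e assume "e \<in> F"
    then have "\<not> e \<subseteq> {x}"
      using F(4) assms(2) card_mono[of "{x}" e] by fastforce
    then show "e \<inter> - {x} \<noteq> {}"
      by blast
  qed
  then obtain f' where f': "f' \<in> G" "x \<notin> f'"
    by blast
  then have "card {f, f'} = 2" "card {f, f'} \<le> card G"
    using f x F(2) by (auto intro!: card_mono simp: card_2_iff)
  then show False
    using F(9) n by simp
qed

text \<open>The method of conditional expectations for a random set containing each point of \<open>C\<close>
  independently with probability \<open>p\<close>.\<close>

lemma exists_separating_set:
  fixes p q :: real and d :: "'i \<Rightarrow> 'c set" and f :: "'j \<Rightarrow> 'c set"
  assumes "finite C" "finite I" "finite J" "p \<ge> 0" "q \<ge> 0" "p + q = 1"
    and "\<And>i. i \<in> I \<Longrightarrow> d i \<subseteq> C" "\<And>j. j \<in> J \<Longrightarrow> f j \<subseteq> C"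
    and "(\<Sum>i\<in>I. p ^ card (d i)) + (\<Sum>j\<in>J. q ^ card (f j)) < 1"
  shows "\<exists>U. (\<forall>i\<in>I. \<not> d i \<subseteq> U) \<and> (\<forall>j\<in>J. f j \<inter> U \<noteq> {})"
  using assms
proof (induction C arbitrary: I J d f rule: finite_induct)
  case empty
  then have "real (card I) + real (card J) < 1"
    by simp
  then have "I = {}" "J = {}"
    using empty.prems(1,2) card_gt_0_iff[of I] card_gt_0_iff[of J] by linarith+
  then show ?case
    by auto
next
  case (insert x C)
  \<comment> \<open>The weights are the probabilities of the bad events
    \<open>d i \<subseteq> U\<close> and \<open>f j \<inter> U = {}\<close>. Given
    \<open>x \<in> U\<close>, the sets \<open>d i\<close> lose \<open>x\<close> and only the
    \<open>f j\<close> in \<open>J'\<close> stay at risk; given \<open>x \<notin> U\<close>, the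
    roles are exchanged. The total weight is the average of the two conditional totals, so one of
    these is below 1.\<close>
  define I' where "I' = {i\<in>I. x \<notin> d i}"
  define J' where "J' = {j\<in>J. x \<notin> f j}"
  define wi where "wi i = p ^ card (d i)" for i
  define wi' where "wi' i = p ^ card (d i - {x})" for i
  define wj where "wj j = q ^ card (f j)" for j
  define wj' where "wj' j = q ^ card (f j - {x})" for j
  have fin: "finite (d i)" if "i \<in> I" for i
    using insert.prems(6)[OF that] insert.hyps(1) finite_subset by blast
  have fin': "finite (f j)" if "j \<in> J" for j
    using insert.prems(7)[OF that] insert.hyps(1) finite_subset by blast
  have card_step: "card s = Suc (card (s - {x}))" if "finite s" "x \<in> s" for s
    using card_Suc_Diff1[OF that] by simp
  have wI: "wi i = p * wi' i + q * (if x \<in> d i then 0 else wi i)" if "i \<in> I" for i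
  proof (cases "x \<in> d i")
    case True
    then show ?thesis
      using card_step[OF fin[OF that] True] by (simp only: wi_def wi'_def power_Suc) simp
  next
    case False
    then have "wi' i = wi i" by (simp add: wi_def wi'_def)
    then show ?thesis
      using False insert.prems(5) by (simp flip: distrib_right)
  qed
  have wJ: "wj j = p * (if x \<in> f j then 0 else wj j) + q * wj' j" if "j \<in> J" for j
  proof (cases "x \<in> f j")
    case True
    then show ?thesis
      using card_step[OF fin'[OF that] True] by (simp only: wj_def wj'_def power_Suc) simp
  next
    case False
    then have "wj' j = wj j" by (simp add: wj_def wj'_def)
    then show ?thesis
      using False insert.prems(5) by (simp flip: distrib_right)
  qed
  have I: "sum wi I = p * sum wi' I + q * sum wi I'"
  proof -
    have "sum wi I = (\<Sum>i\<in>I. p * wi' i + q * (if x \<in> d i then 0 else wi i))"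
      by (intro sum.cong refl wI)
    also have "\<dots> = p * sum wi' I + q * (\<Sum>i\<in>I. if x \<in> d i then 0 else wi i)"
      by (simp add: sum.distrib sum_distrib_left)
    also have "(\<Sum>i\<in>I. if x \<in> d i then 0 else wi i) = sum wi I'"
      unfolding I'_def using insert.prems(1) by (simp add: sum.If_cases Int_def)
    finally show ?thesis .
  qed
  have J: "sum wj J = p * sum wj J' + q * sum wj' J"
  proof -
    have "sum wj J = (\<Sum>j\<in>J. p * (if x \<in> f j then 0 else wj j) + q * wj' j)"
      by (intro sum.cong refl wJ)
    also have "\<dots> = p * (\<Sum>j\<in>J. if x \<in> f j then 0 else wj j) + q * sum wj' J"
      by (simp add: sum.distrib sum_distrib_left)
    also have "(\<Sum>j\<in>J. if x \<in> f j then 0 else wj j) = sum wj J'"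
      unfolding J'_def using insert.prems(2) by (simp add: sum.If_cases Int_def)
    finally show ?thesis .
  qed
  have "p * (sum wi' I + sum wj J') + q * (sum wi I' + sum wj' J) < 1"
    using insert.prems(8) I J unfolding wi_def wj_def by (simp add: algebra_simps)
  then have "sum wi' I + sum wj J' < 1 \<or> sum wi I' + sum wj' J < 1"
    using mult_left_mono[of 1 "sum wi' I + sum wj J'" p] insert.prems(3,4,5)
      mult_left_mono[of 1 "sum wi I' + sum wj' J" q]
    by linarith
  then show ?case
  proof
    assume "sum wi' I + sum wj J' < 1"
    then have "\<exists>U. (\<forall>i\<in>I. \<not> d i - {x} \<subseteq> U) \<and> (\<forall>j\<in>J'. f j \<inter> U \<noteq> {})"
      using insert.prems unfolding wi'_def wj_def
      by (intro insert.IH) (auto simp: J'_def)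
    then obtain U where U: "\<forall>i\<in>I. \<not> d i - {x} \<subseteq> U" "\<forall>j\<in>J'. f j \<inter> U \<noteq> {}"
      by blast
    then show ?case
      by (intro exI[of _ "insert x U"]) (auto simp: J'_def)
  next
    assume "sum wi I' + sum wj' J < 1"
    then have "\<exists>U. (\<forall>i\<in>I'. \<not> d i \<subseteq> U) \<and> (\<forall>j\<in>J. (f j - {x}) \<inter> U \<noteq> {})"
      using insert.prems unfolding wi_def wj'_def
      by (intro insert.IH) (auto simp: I'_def)
    then obtain U where U: "\<forall>i\<in>I'. \<not> d i \<subseteq> U" "\<forall>j\<in>J. (f j - {x}) \<inter> U \<noteq> {}"
      by blast
    then show ?case
      by (intro exI[of _ "U - {x}"]) (auto simp: I'_def)
  qed
qed

text \<open>Otherwise some \<open>U\<close> contains no member of \<open>F\<close> and meets every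
  member of \<open>G\<close>. Its complement is then a transversal of \<open>F\<close> containing no
  member of \<open>G\<close>.\<close>

lemma blocked_weight:
  fixes p :: real
  assumes "blocked k m n b" "0 \<le> p" "p \<le> 1"
  shows "m * p ^ k + n * (1 - p) ^ b \<ge> 1"
proof (rule ccontr)
  assume less: "\<not> ?thesis"
  obtain F G :: "nat set set" where sys: "blocking_system F G k b"
    and card: "card F \<le> m" "card G \<le> n"
    by (rule blockedE[OF assms(1)])
  note F = blocking_systemD[OF sys] card
  have "(\<Sum>e\<in>F. p ^ card (id e)) + (\<Sum>f\<in>G. (1 - p) ^ card (id f))
      = card F * p ^ k + card G * (1 - p) ^ b"
    using F(4,6) by simp
  also have "\<dots> \<le> m * p ^ k + n * (1 - p) ^ b"
    using F(8,9) assms by (intro add_mono mult_right_mono) auto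
  finally have "\<exists>U. (\<forall>e\<in>F. \<not> id e \<subseteq> U) \<and> (\<forall>f\<in>G. id f \<inter> U \<noteq> {})"
    using less F(1-3,5) assms
    by (intro exists_separating_set[of "\<Union>F \<union> \<Union>G" F G p "1 - p"]) auto
  then obtain U where U: "\<forall>e\<in>F. \<not> e \<subseteq> U" "\<forall>f\<in>G. f \<inter> U \<noteq> {}"
    by auto
  have "\<exists>f\<in>G. f \<subseteq> - U"
    using U(1) by (intro F(7)) blast
  then show False
    using U(2) by blast
qed

text \<open>With \<open>p = 2 * ln n / b\<close> the right lists contribute at most
  \<open>1 / n \<le> 1 / 2\<close> to the weight, so \<open>m * p ^ k \<ge> 1 / 2\<close>. If this
  \<open>p\<close> exceeds 1, then \<open>ln n / b\<close> is above \<open>1 / 2\<close> and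
  \<open>m \<ge> 1\<close> suffices.\<close>

lemma blocked_lower_bound:
  assumes bl: "blocked k m n b" and k: "k \<ge> 2" and b: "b > 0"
  shows "real m * ln (real n) ^ k / real b ^ k \<ge> (1 / 8) ^ k"
proof -
  define g where "g = ln (real n)"
  have n: "n \<ge> 2"
    using blocked_imp_two_le[OF bl k b] .
  then have g: "g > 0" and en: "exp g = n"
    by (auto simp: g_def)
  have m: "m \<ge> 1"
    using blocked_pos[OF bl b] by simp
  show ?thesis
  proof (cases "b < 2 * g")
    case True
    have "(1 / 8) ^ k \<le> (g / b) ^ k"
      using True b by (intro power_mono) (auto simp: field_simps)
    also have "\<dots> \<le> m * (g / b) ^ k"
      using mult_right_mono[of 1 "real m" "(g / b) ^ k"] m g by simp
    finally show ?thesis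
      by (simp add: g_def power_divide)
  next
    case False
    define p where "p = 2 * g / b"
    have p: "0 \<le> p" "p \<le> 1"
      using False g b by (auto simp: p_def)
    have "(1 - p) ^ b \<le> exp (- p) ^ b"
      using p exp_ge_add_one_self[of "- p"] by (intro power_mono) auto
    also have "\<dots> = exp (- g) * exp (- g)"
      using b by (simp add: p_def exp_of_nat_mult[symmetric] exp_add[symmetric])
    finally have "n * (1 - p) ^ b \<le> exp g * (exp (- g) * exp (- g))"
      unfolding en using en by (intro mult_left_mono) auto
    also have "\<dots> = 1 / n"
      using en by (simp add: exp_minus field_simps)
    also have "\<dots> \<le> 1 / 2"
      using n by (simp add: field_simps)
    finally have "1 / 2 \<le> m * p ^ k"
      using blocked_weight[OF bl p] by linarith
    also have "\<dots> = 2 ^ k * (m * g ^ k / b ^ k)"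
      by (simp add: p_def power_divide power_mult_distrib)
    finally have *: "(1 / 2) / 2 ^ k \<le> m * g ^ k / b ^ k"
      by (simp add: field_simps)
    have "(1 / 8 :: real) ^ k = (1 / 4) ^ k * (1 / 2) ^ k"
      by (simp flip: power_mult_distrib)
    also have "\<dots> \<le> (1 / 2) * (1 / 2) ^ k"
      using power_decreasing[of 1 k "1 / 4 :: real"] k by (intro mult_right_mono) auto
    finally show ?thesis
      using * by (simp add: power_divide g_def)
  qed
qed

section \<open>Normalised parameters of blocking systems\<close>

text \<open>The factor \<open>b\<^sup>k\<close> normalises \<open>m\<close> so that blow-ups leave \<open>h\<close> unchanged.\<close>

definition attains :: "nat \<Rightarrow> real \<Rightarrow> real \<Rightarrow> bool" where
  "attains k g h \<longleftrightarrow>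
     (\<exists>m n b. n > 0 \<and> b > 0 \<and> blocked k m n b \<and> ln (real n) \<le> g \<and> real m \<le> h * real b ^ k)"

lemma attains_0: "g \<ge> 0 \<Longrightarrow> attains 0 g 1"
  unfolding attains_def using blocked_0[of 1 1] by (intro exI[of _ 1]) auto

lemma attains_1: "g \<ge> 0 \<Longrightarrow> attains 1 g 1"
  unfolding attains_def using blocked_1[of 1] by (intro exI[of _ 1]) auto

text \<open>The list size grows by the factor \<open>s\<close>, which gains \<open>s ^ k\<close> in
  the normalisation. In total \<open>h * g ^ k\<close> grows only by the factor
  \<open>s\<close>.\<close>

lemma attains_copies:
  fixes s :: nat and g h :: real
  assumes "attains k g h" "s > 0"
  shows "attains k (s * g) (s * h / s ^ k)"
proof -
  obtain m n b where *: "n > 0" "b > 0" "blocked k m n b" "ln n \<le> g" "m \<le> h * real b ^ k"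
    using assms unfolding attains_def by blast
  have "real s * real m \<le> real s * (h * real b ^ k)"
    using *(5) by (rule mult_left_mono) simp
  also have "\<dots> = s * h / s ^ k * (s * b) ^ k"
    using assms(2) by (simp add: power_mult_distrib)
  finally have "real (s * m) \<le> s * h / s ^ k * real (s * b) ^ k"
    by simp
  moreover have "ln (real (n ^ s)) \<le> s * g"
    using *(1,4) by (simp add: ln_realpow mult_left_mono)
  ultimately show ?thesis
    unfolding attains_def using blocked_copies[OF *(3), of s] *(1,2) assms(2)
    by (intro exI[of _ "s * m"] exI[of _ "n ^ s"] exI[of _ "s * b"]) simp
qed

text \<open>Blow-ups by \<open>b2\<close> and \<open>b1\<close> bring both list sizes to
  \<open>b1 * b2\<close>. The term \<open>ln 2\<close> accounts for
  \<open>n1 + n2 \<le> 2 * exp g\<close>.\<close>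

lemma attains_add:
  assumes 1: "attains k1 g h1" and 2: "attains k2 g h2"
  shows "attains (k1 + k2) (g + ln 2) (h1 * h2)"
proof -
  obtain m1 n1 b1 where 1: "n1 > 0" "b1 > 0" "blocked k1 m1 n1 b1" "ln n1 \<le> g" "m1 \<le> h1 * b1 ^ k1"
    using 1 unfolding attains_def by blast
  obtain m2 n2 b2 where 2: "n2 > 0" "b2 > 0" "blocked k2 m2 n2 b2" "ln n2 \<le> g" "m2 \<le> h2 * b2 ^ k2"
    using 2 unfolding attains_def by blast
  let ?m1 = "b2 ^ k1 * m1" and ?m2 = "b1 ^ k2 * m2"
  have bl: "blocked (k1 + k2) (?m1 * ?m2) (n1 + n2) (b1 * b2)"
    using blocked_blowup[OF 1(3), of b2] blocked_blowup[OF 2(3), of b1]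
    by (intro blocked_add) (auto simp: mult.commute)
  have "real n1 \<le> exp g" "real n2 \<le> exp g"
    using 1 2 by (metis exp_le_cancel_iff exp_ln of_nat_0_less_iff)+
  then have "real (n1 + n2) \<le> exp (g + ln 2)"
    by (simp add: exp_add)
  then have n: "ln (real (n1 + n2)) \<le> g + ln 2"
    using 1(1) by (metis add_gr_0 ln_exp ln_le_cancel_iff exp_gt_zero of_nat_0_less_iff)
  have "real m1 * real m2 \<le> (h1 * b1 ^ k1) * (h2 * b2 ^ k2)"
    using 1(5) 2(5) by (intro mult_mono) (auto intro: order_trans[OF of_nat_0_le_iff])
  then have "real b2 ^ k1 * real b1 ^ k2 * (real m1 * real m2)
      \<le> real b2 ^ k1 * real b1 ^ k2 * ((h1 * b1 ^ k1) * (h2 * b2 ^ k2))"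
    by (intro mult_left_mono) auto
  then have "real (?m1 * ?m2) \<le> h1 * h2 * real (b1 * b2) ^ (k1 + k2)"
    by (simp add: algebra_simps power_add power_mult_distrib)
  then show ?thesis
    unfolding attains_def using bl n 1(1,2) 2(2)
    by (intro exI[of _ "?m1 * ?m2"] exI[of _ "n1 + n2"] exI[of _ "b1 * b2"]) auto
qed

lemma attains_nonneg:
  assumes "attains k g h"
  shows "g \<ge> 0"
  using assms unfolding attains_def
  by (metis ln_ge_zero of_nat_0_less_iff of_nat_1 of_nat_le_iff order_trans Suc_leI One_nat_def)

text \<open>Multiplying by the trivial system of \<open>attains_1\<close> costs \<open>ln 2\<close>
  in \<open>g\<close> and nothing in \<open>h\<close>. This fills the gaps between multiples of a
  fixed \<open>k\<close>.\<close>

lemma attains_add_const: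
  assumes "attains k g h"
  shows "attains (k + r) (g + r * ln 2) h"
proof (induction r)
  case 0
  then show ?case using assms by simp
next
  case (Suc r)
  have "attains (k + r + 1) (g + r * ln 2 + ln 2) (h * 1)"
    by (intro attains_add Suc attains_1 attains_nonneg[OF Suc])
  then show ?case
    by (simp add: algebra_simps)
qed

section \<open>The infimum in terms of blocking systems\<close>

definition blocked_values :: "nat \<Rightarrow> real set" where
  "blocked_values k =
     {real m * ln (real n) ^ k / real b ^ k | n m b. n > 0 \<and> b > 0 \<and> blocked k m n b}"

lemma xi_m'_eq:
  assumes "k > 0"
  shows "xi_m' k = Inf (blocked_values k)"
proof -
  have "n > 0 \<and> m > 0 \<and> b > 0 \<and> \<not> K_choosable m n k b \<longleftrightarrow> n > 0 \<and> b > 0 \<and> blocked k m n b"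
    for m n b
    using not_K_choosable_iff_blocked[OF assms] blocked_pos by blast
  then show ?thesis
    unfolding xi_m'_def blocked_values_def by simp
qed

lemma xi_m'_le:
  assumes "attains k g h" "k > 0"
  shows "xi_m' k \<le> h * g ^ k"
proof -
  obtain m n b where *: "n > 0" "b > 0" "blocked k m n b" "ln (real n) \<le> g" "real m \<le> h * real b ^ k"
    using assms(1) unfolding attains_def by blast
  have "xi_m' k \<le> real m * ln (real n) ^ k / real b ^ k"
    unfolding xi_m'_eq[OF assms(2)]
  proof (rule cInf_lower)
    show "real m * ln (real n) ^ k / real b ^ k \<in> blocked_values k"
      using * unfolding blocked_values_def by blast
    show "bdd_below (blocked_values k)"
      unfolding blocked_values_def by (rule bdd_belowI[of _ 0]) (auto simp: Suc_le_eq)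
  qed
  also have "\<dots> \<le> (h * real b ^ k) * g ^ k / real b ^ k"
    using * by (intro divide_right_mono mult_mono power_mono) (auto simp: Suc_le_eq)
  also have "\<dots> = h * g ^ k"
    using * by simp
  finally show ?thesis .
qed

lemma blocked_values_nonempty: "blocked_values k \<noteq> {}"
proof -
  have "attains k (0 + k * ln 2) 1"
    using attains_add_const[OF attains_0[of 0], of k] by simp
  then show ?thesis
    unfolding attains_def blocked_values_def by blast
qed

lemma xi_m'_ge:
  assumes k: "k \<ge> 2"
  shows "xi_m' k \<ge> (1 / 8) ^ k"
proof -
  have "(1 / 8) ^ k \<le> Inf (blocked_values k)"
  proof (rule cInf_greatest[OF blocked_values_nonempty])
    fix x assume "x \<in> blocked_values k"
    then obtain m n b where "x = real m * ln (real n) ^ k / real b ^ k" "b > 0" "blocked k m n b"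
      unfolding blocked_values_def by blast
    then show "(1 / 8) ^ k \<le> x"
      using blocked_lower_bound[of k m n b] k by simp
  qed
  then show ?thesis
    using xi_m'_eq[of k] k by simp
qed

lemma xi_m'_pos: "k \<ge> 2 \<Longrightarrow> xi_m' k > 0"
  using xi_m'_ge[of k] by (rule order.strict_trans2[rotated]) simp_all

text \<open>Positivity of \<open>xi_m' k\<close> puts the infimum strictly below its double. The
  bound on \<open>g\<close> comes from \<open>n \<ge> 2\<close>.\<close>

lemma xi_m'_nearly_attained:
  assumes k: "k \<ge> 2"
  obtains g h where "attains k g h" "h > 0" "g \<ge> ln 2" "h * g ^ k \<le> 2 * xi_m' k"
proof -
  have "Inf (blocked_values k) < 2 * xi_m' k"
    using xi_m'_pos[OF k] xi_m'_eq[of k] k by simp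
  from cInf_lessD[OF blocked_values_nonempty this]
  obtain m n b where x: "real m * ln (real n) ^ k / real b ^ k < 2 * xi_m' k"
    and nb: "n > 0" "b > 0" and bl: "blocked k m n b"
    unfolding blocked_values_def by blast
  have m: "m > 0"
    using blocked_pos[OF bl nb(2)] .
  have n: "n \<ge> 2"
    using blocked_imp_two_le[OF bl k nb(2)] .
  show ?thesis
  proof (rule that[of "ln n" "m / real b ^ k"])
    show "attains k (ln n) (m / real b ^ k)"
      unfolding attains_def using nb bl
      by (intro exI[of _ m] exI[of _ n] exI[of _ b]) simp
  qed (use nb n m x in auto)
qed

section \<open>Repeated doubling\<close>

text \<open>By \<open>1 + y \<le> exp y\<close>, raising a base \<open>x \<ge> n\<close> by
  \<open>r * ln 2\<close> changes its \<open>n\<close>-th power by a factor of at most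
  \<open>2 ^ r\<close>.\<close>

lemma power_one_plus_le_power_two:
  fixes x :: real
  assumes "x > 0" "real n \<le> x"
  shows "(1 + r * ln 2 / x) ^ n \<le> 2 ^ r"
proof -
  have "(1 + r * ln 2 / x) ^ n \<le> exp (r * ln 2 / x) ^ n"
    using assms by (intro power_mono exp_ge_add_one_self add_nonneg_nonneg) auto
  also have "\<dots> = exp (n * (r * ln 2 / x))"
    by (rule exp_of_nat_mult[symmetric])
  also have "n * (r * ln 2 / x) = r * ln 2 * (n / x)"
    by simp
  also have "exp \<dots> \<le> exp (r * ln 2 * 1)"
    unfolding exp_le_cancel_iff using assms by (intro mult_left_mono) auto
  also have "\<dots> = 2 ^ r"
    by (simp add: exp_of_nat_mult)
  finally show ?thesis .
qed

text \<open>Halving \<open>m\<close> at every level makes the two factors of a product have equal \<open>g\<close>, and the two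
  copies taken before each product keep \<open>g\<close> above \<open>m * k\<close>, so the increment \<open>ln 2\<close> of \<open>g\<close> is
  harmless. The losses multiply to \<open>8 ^ (2 ^ j - 1)\<close>.\<close>

lemma attains_multiple:
  fixes g h :: real
  assumes a: "attains k g h" "h > 0" "g \<ge> real k" "k > 0"
  defines "G \<equiv> \<lambda>j. 2 ^ j * (g + ln 2) - ln 2"
  assumes "m \<le> 2 ^ j"
  shows "\<exists>h'>0. attains (m * k) (G j) h' \<and> h' * G j ^ (m * k) \<le> 8 ^ 2 ^ j / 8 * (h * g ^ k) ^ m"
  using \<open>m \<le> 2 ^ j\<close>
proof (induction j arbitrary: m)
  case 0
  have "g > 0"
    using a(3,4) by linarith
  from 0 consider "m = 0" | "m = 1"
    by fastforce
  then show ?case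
  proof cases
    case 1
    then show ?thesis
      using attains_0[of g] \<open>g > 0\<close> by (intro exI[of _ 1]) (simp add: G_def)
  next
    case 2
    then show ?thesis
      using a by (intro exI[of _ h]) (simp add: G_def)
  qed
next
  case (Suc j)
  let ?R = "h * g ^ k"
  have gpos: "g > 0"
    using a(3,4) by linarith
  define m1 m2 where "m1 = m div 2" and "m2 = m - m div 2"
  have m12: "m = m1 + m2" "m1 \<le> 2 ^ j" "m2 \<le> 2 ^ j"
    using Suc.prems unfolding m1_def m2_def by auto
  obtain h1 where h1: "h1 > 0" "attains (m1 * k) (G j) h1"
      "h1 * G j ^ (m1 * k) \<le> 8 ^ 2 ^ j / 8 * ?R ^ m1"
    using Suc.IH[OF m12(2)] by blast
  obtain h2 where h2: "h2 > 0" "attains (m2 * k) (G j) h2"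
      "h2 * G j ^ (m2 * k) \<le> 8 ^ 2 ^ j / 8 * ?R ^ m2"
    using Suc.IH[OF m12(3)] by blast
  \<comment> \<open>Two copies double \<open>g\<close> and the product adds \<open>ln 2\<close>; the
    closed form of \<open>G\<close> solves this recursion with \<open>G 0 = g\<close>.\<close>
  have G: "G (Suc j) = 2 * G j + ln 2"
    by (simp add: G_def algebra_simps)
  have "1 * ln 2 \<le> 2 ^ j * ln (2 :: real)"
    by (intro mult_right_mono) auto
  then have "2 ^ j * g \<le> G j"
    by (simp add: G_def algebra_simps)
  moreover have "2 ^ j * real k \<le> 2 ^ j * g"
    using a(3) by (intro mult_left_mono) auto
  ultimately have Gk: "2 ^ j * real k \<le> G j"
    by linarith
  moreover have "0 < 2 ^ j * real k"
    using a(4) by simp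
  ultimately have Gpos: "G j > 0"
    by linarith
  have "real m \<le> 2 ^ Suc j"
    using Suc.prems by (metis of_nat_le_iff of_nat_numeral of_nat_power)
  then have "real (m * k) \<le> 2 ^ Suc j * real k"
    by (simp add: mult_right_mono)
  then have mk: "real (m * k) \<le> 2 * G j"
    using Gk by simp
  define h' where "h' = (2 * h1 / 2 ^ (m1 * k)) * (2 * h2 / 2 ^ (m2 * k))"
  have "attains (m1 * k + m2 * k) (2 * G j + ln 2) h'"
    unfolding h'_def
    using attains_add[OF attains_copies[OF h1(2), of 2] attains_copies[OF h2(2), of 2]] by simp
  then have att: "attains (m * k) (G (Suc j)) h'"
    by (simp add: G m12(1) distrib_right)
  have "G (Suc j) = 2 * G j * (1 + real 1 * ln 2 / (2 * G j))"
    using Gpos by (simp add: G field_simps)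
  then have "h' * G (Suc j) ^ (m * k)
      = h' * (2 * G j) ^ (m * k) * (1 + real 1 * ln 2 / (2 * G j)) ^ (m * k)"
    by (simp only: power_mult_distrib mult.assoc)
  also have "\<dots> \<le> h' * (2 * G j) ^ (m * k) * 2 ^ 1"
    using mk Gpos h1(1) h2(1)
    by (intro mult_left_mono power_one_plus_le_power_two) (auto simp: h'_def)
  also have "(2 * G j) ^ (m * k) = 2 ^ (m1 * k) * 2 ^ (m2 * k) * (G j ^ (m1 * k) * G j ^ (m2 * k))"
    by (simp add: m12(1) power_add power_mult_distrib distrib_right)
  \<comment> \<open>The powers of 2 in \<open>h'\<close> cancel. The loss 8 consists of a factor 2
    for each of the two doublings and a factor 2 for the shift by \<open>ln 2\<close>; with the two
    induction bounds it reproduces \<open>8 ^ 2 ^ Suc j / 8\<close>.\<close>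
  also have "h' * \<dots> * 2 ^ 1 = 8 * ((h1 * G j ^ (m1 * k)) * (h2 * G j ^ (m2 * k)))"
    by (simp add: h'_def)
  also have "\<dots> \<le> 8 * ((8 ^ 2 ^ j / 8 * ?R ^ m1) * (8 ^ 2 ^ j / 8 * ?R ^ m2))"
    using h2(1) Gpos a(2) gpos by (intro mult_left_mono mult_mono[OF h1(3) h2(3)]) auto
  also have "\<dots> = (8 ^ 2 ^ j * 8 ^ 2 ^ j) / 8 * (?R ^ m1 * ?R ^ m2)"
    by simp
  also have "\<dots> = 8 ^ 2 ^ Suc j / 8 * ?R ^ m"
    unfolding m12(1) power_add power_Suc mult_2 ..
  finally show ?case
    using att h1(1) h2(1) by (intro exI[of _ h']) (simp add: h'_def)
qed

lemma ex_power_two_between: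
  assumes "m > 0"
  shows "\<exists>j. m \<le> 2 ^ j \<and> 2 ^ j \<le> 2 * (m :: nat)"
proof -
  obtain j where "2 ^ j \<le> m" "m < 2 ^ (j + 1)"
    using ex_power_ivl1[of 2 m] assms by auto
  then show ?thesis
    by (intro exI[of _ "Suc j"]) auto
qed

text \<open>The factor 256 is \<open>64 * 4\<close>: doubling with \<open>2 ^ j \<le> 2 * m\<close>
  loses at most \<open>64 ^ m\<close>, while near-optimality and the \<open>2 * k\<close> initial
  copies turn \<open>xi_m' k\<close> into \<open>4 * k * xi_m' k\<close>. The other factors pay for
  the \<open>r\<close> trivial steps and do not grow exponentially in \<open>m\<close>.\<close>

lemma xi_m'_multiple_add_le:
  assumes k: "k \<ge> 2"
  shows "\<exists>c>0. \<forall>m>0. \<forall>r<k.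
    xi_m' (m * k + r) \<le> (256 * real k * xi_m' k) ^ m * 2 ^ k * (c * real m) ^ k"
proof -
  obtain g0 h0 where a0: "attains k g0 h0" "h0 > 0" "g0 \<ge> ln 2" "h0 * g0 ^ k \<le> 2 * xi_m' k"
    using xi_m'_nearly_attained[OF k] by blast
  \<comment> \<open>Since \<open>g0 \<ge> ln 2 \<ge> 1 / 2\<close>, taking \<open>2 * k\<close>
    copies achieves \<open>g \<ge> k\<close>, as \<open>attains_multiple\<close> requires.\<close>
  define g h where "g = real (2 * k) * g0" and "h = real (2 * k) * h0 / real (2 * k) ^ k"
  have a: "attains k g h"
    unfolding g_def h_def of_nat_power[symmetric] using attains_copies[OF a0(1), of "2 * k"] k by simp
  have h: "h > 0"
    using a0 k by (simp add: h_def)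
  have "1 / 2 \<le> ln (2 :: real)"
    using ln_le_minus_one[of "1 / 2 :: real"] by (simp add: ln_div)
  then have "real (2 * k) * (1 / 2) \<le> g"
    unfolding g_def using a0(3) by (intro mult_left_mono) auto
  then have gk: "g \<ge> real k"
    by simp
  have "h * g ^ k = real (2 * k) * (h0 * g0 ^ k)"
    using k by (simp add: g_def h_def power_mult_distrib)
  also have "\<dots> \<le> real (2 * k) * (2 * xi_m' k)"
    using a0(4) by (intro mult_left_mono) auto
  finally have R: "h * g ^ k \<le> 4 * real k * xi_m' k"
    by simp
  \<comment> \<open>Chosen so that \<open>G + r * ln 2 \<le> c * m\<close>: the part
    \<open>2 * g + 2\<close> covers \<open>G\<close>, the part \<open>k\<close> covers the
    \<open>r\<close> trivial steps.\<close>
  define c where "c = 2 * g + 2 + k"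
  have c: "c \<ge> 1"
    using gk by (simp add: c_def)
  have "xi_m' (m * k + r) \<le> (256 * real k * xi_m' k) ^ m * 2 ^ k * (c * real m) ^ k"
    if m: "m > 0" and r: "r < k" for m r
  proof -
    obtain j where j: "m \<le> 2 ^ j" "2 ^ j \<le> 2 * m"
      using ex_power_two_between[OF m] by blast
    define G where "G = 2 ^ j * (g + ln 2) - ln 2"
    obtain h' where h': "h' > 0" "attains (m * k) G h'"
        "h' * G ^ (m * k) \<le> 8 ^ 2 ^ j / 8 * (h * g ^ k) ^ m"
      unfolding G_def using attains_multiple[OF a h gk _ j(1)] k by auto
    have "1 * ln 2 \<le> 2 ^ j * ln (2 :: real)"
      by (intro mult_right_mono) auto
    then have "2 ^ j * g \<le> G"
      by (simp add: G_def algebra_simps)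
    moreover have "real m \<le> 2 ^ j"
      using j(1) by (metis of_nat_le_iff of_nat_numeral of_nat_power)
    then have "real m * real k \<le> 2 ^ j * g"
      using gk by (intro mult_mono) auto
    ultimately have Gmk: "real (m * k) \<le> G"
      by simp
    then have Gpos: "G > 0"
      using m k by (intro order.strict_trans2[OF _ Gmk]) simp
    have "2 ^ j \<le> 2 * real m"
      using j(2) by (metis of_nat_le_iff of_nat_mult of_nat_numeral of_nat_power)
    then have "2 ^ j * (g + ln 2) \<le> 2 * real m * (g + 1)"
      using gk ln_2_less_1 by (intro mult_mono) auto
    moreover have "real r * ln 2 \<le> real k * real m"
      using r m ln_2_less_1 by (intro mult_mono) auto
    moreover have "c * m = 2 * real m * (g + 1) + real k * real m"
      by (simp add: c_def algebra_simps)
    moreover have "ln 2 > (0 :: real)"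
      by simp
    ultimately have Gr: "G + r * ln 2 \<le> c * m"
      unfolding G_def by linarith
    have cm: "1 \<le> c * m"
      using mult_mono[of 1 c 1 "real m"] c m by simp
    have "xi_m' (m * k + r) \<le> h' * (G + r * ln 2) ^ (m * k + r)"
      using attains_add_const[OF h'(2), of r] m k by (intro xi_m'_le) auto
    also have "\<dots> = h' * (G * (1 + r * ln 2 / G)) ^ (m * k) * (G + r * ln 2) ^ r"
      using Gpos by (simp add: power_add distrib_left)
    also have "\<dots> = (h' * G ^ (m * k)) * (1 + r * ln 2 / G) ^ (m * k) * (G + r * ln 2) ^ r"
      by (simp only: power_mult_distrib mult.assoc)
    also have "\<dots> \<le> (64 ^ m * (4 * real k * xi_m' k) ^ m) * 2 ^ k * (c * real m) ^ k"
    proof -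
      have "(8 :: real) ^ 2 ^ j \<le> 8 ^ (2 * m)"
        using j(2) by (intro power_increasing) auto
      also have "\<dots> = 64 ^ m"
        by (simp add: power_mult)
      finally have 8: "(8 :: real) ^ 2 ^ j / 8 \<le> 64 ^ m"
        using zero_le_power[of "8 :: real" "2 ^ j"] by linarith
      have "(h * g ^ k) ^ m \<le> (4 * real k * xi_m' k) ^ m"
        using h gk by (intro power_mono[OF R]) auto
      then have "8 ^ 2 ^ j / 8 * (h * g ^ k) ^ m \<le> 64 ^ m * (4 * real k * xi_m' k) ^ m"
        using h gk by (intro mult_mono[OF 8]) auto
      then have 1: "h' * G ^ (m * k) \<le> 64 ^ m * (4 * real k * xi_m' k) ^ m"
        using h'(3) by (rule order_trans[rotated])
      have "(1 + r * ln 2 / G) ^ (m * k) \<le> 2 ^ r"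
        using Gpos Gmk by (rule power_one_plus_le_power_two)
      also have "\<dots> \<le> 2 ^ k"
        using r by (intro power_increasing) auto
      finally have 2: "(1 + r * ln 2 / G) ^ (m * k) \<le> 2 ^ k" .
      have "(G + r * ln 2) ^ r \<le> (c * m) ^ r"
        using Gr Gpos by (intro power_mono) auto
      also have "\<dots> \<le> (c * m) ^ k"
        using r cm by (intro power_increasing) auto
      finally have 3: "(G + r * ln 2) ^ r \<le> (c * m) ^ k" .
      have "0 \<le> h' * G ^ (m * k)" "0 \<le> (1 + r * ln 2 / G) ^ (m * k)" "0 \<le> (G + r * ln 2) ^ r"
        using Gpos h'(1) by auto
      then show ?thesis
        using xi_m'_pos[OF k] by (intro mult_mono 1 2 3) auto
    qed
    also have "64 ^ m * (4 * real k * xi_m' k) ^ m = (64 * (4 * real k * xi_m' k)) ^ m"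
      by (rule power_mult_distrib[symmetric])
    also have "64 * (4 * real k * xi_m' k) = 256 * real k * xi_m' k"
      by simp
    finally show ?thesis .
  qed
  moreover have "c > 0"
    using c by simp
  ultimately show ?thesis
    by (intro exI[of _ c] conjI allI impI)
qed

section \<open>Existence of the limit\<close>

lemma eventually_ln_xi_m'_le:
  assumes k: "k \<ge> 2" and \<epsilon>: "\<epsilon> > 0"
  shows "eventually (\<lambda>n. ln (xi_m' n) / n \<le> ln (xi_m' k) / k + ln (256 * real k) / k + \<epsilon>) sequentially"
proof -
  define Q where "Q = ln (256 * real k * xi_m' k)"
  have pos: "256 * real k * xi_m' k > 0"
    using xi_m'_pos[OF k] k by simp
  obtain c where c: "c > 0" and le: "\<forall>m>0. \<forall>r<k.
      xi_m' (m * k + r) \<le> (256 * real k * xi_m' k) ^ m * 2 ^ k * (c * real m) ^ k"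
    using xi_m'_multiple_add_le[OF k] by (elim exE conjE)
  have "(\<lambda>n. (D + K * ln (c * real n)) / real n) \<longlonglongrightarrow> 0" for D K :: real
    using c by real_asymp
  from this[of "\<bar>Q\<bar> + real k * ln 2" "real k"] have "eventually (\<lambda>n. (\<bar>Q\<bar> + real k * ln 2 + real k * ln (c * real n)) / real n < \<epsilon>) sequentially"
    using \<epsilon> by (rule order_tendstoD)
  then show ?thesis
    using eventually_ge_at_top[of k]
  proof eventually_elim
    case (elim n)
    define m r where "m = n div k" and "r = n mod k"
    have n: "n = m * k + r" and r: "r < k" and m: "m > 0" and mn: "m \<le> n"
      using elim k by (auto simp: m_def r_def div_greater_zero_iff)
    have n0: "real n > 0" "n \<ge> 2" and k0: "real k > 0"
      using elim k by auto
    have "ln (xi_m' n) \<le> ln ((256 * real k * xi_m' k) ^ m * 2 ^ k * (c * real m) ^ k)"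
      using le[rule_format, OF m r] xi_m'_pos[OF n0(2)] n by simp
    also have "\<dots> = m * Q + k * ln 2 + k * ln (c * m)"
      using pos c m unfolding Q_def by (simp add: ln_mult_pos ln_realpow)
    also have "k * ln (c * m) \<le> k * ln (c * n)"
      using c m mn by (intro mult_left_mono) auto
    \<comment> \<open>\<open>m\<close> differs from \<open>n / k\<close> by less than 1. The sign of
      \<open>Q\<close> is unknown, hence the absolute value.\<close>
    also have "m * Q \<le> Q / k * n + \<bar>Q\<bar>"
    proof -
      have "Q / k * n = m * Q + Q * (r / k)"
        using k0 by (simp add: n field_simps)
      moreover have "- Q * (r / k) \<le> \<bar>Q\<bar> * 1"
        using r by (intro mult_mono) auto
      ultimately show ?thesis
        by simp
    qed
    finally have "ln (xi_m' n) \<le> Q / k * n + (\<bar>Q\<bar> + k * ln 2 + k * ln (c * n))"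
      by simp
    then have "ln (xi_m' n) / n \<le> (Q / k * n + (\<bar>Q\<bar> + k * ln 2 + k * ln (c * n))) / n"
      using n0 by (intro divide_right_mono) auto
    also have "\<dots> = Q / k + (\<bar>Q\<bar> + k * ln 2 + k * ln (c * n)) / n"
      using n0 by (simp add: add_divide_distrib)
    also have "Q / k = ln (xi_m' k) / k + ln (256 * real k) / k"
      using xi_m'_pos[OF k] k0 unfolding Q_def by (simp add: ln_mult_pos add_divide_distrib)
    finally show ?case
      using elim(1) by simp
  qed
qed

theorem theorem1p9: "\<exists>l :: real. (\<lambda>k. ln (xi_m' k) / real k) \<longlonglongrightarrow> l"
proof -
  define e where "e k = ln (256 * real k) / real k" for k :: nat
  define a where "a k = ln (xi_m' k) / real k" for k
  \<comment> \<open>As in Fekete's lemma, the limit is an infimum: \<open>l \<le> a k + e k\<close>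
    with \<open>e\<close> tending to 0 bounds \<open>a\<close> from below, and eventually
    \<open>a n\<close> is nearly at most any single \<open>a k + e k\<close>. The index starts at 2,
    where \<open>xi_m'\<close> is positive.\<close>
  define l where "l = (INF k\<in>{2..}. a k + e k)"
  have e: "e \<longlonglongrightarrow> 0"
    unfolding e_def by real_asymp
  have bdd: "bdd_below ((\<lambda>k. a k + e k) ` {2..})"
  proof (rule bdd_belowI2)
    fix k :: nat assume k: "k \<in> {2..}"
    have "ln ((1 / 8) ^ k) \<le> ln (xi_m' k)"
      using xi_m'_ge[of k] xi_m'_pos[of k] k by simp
    then have "ln (1 / 8) * real k \<le> ln (xi_m' k)"
      by (subst (asm) ln_realpow) (simp_all add: mult.commute)
    then have "ln (1 / 8) \<le> a k"
      using k unfolding a_def by (simp add: pos_le_divide_eq)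
    moreover have "0 \<le> e k"
      using k unfolding e_def by simp
    ultimately show "ln (1 / 8) \<le> a k + e k"
      by simp
  qed
  have "a \<longlonglongrightarrow> l"
  proof (rule order_tendstoI)
    fix y assume "y < l"
    then have "eventually (\<lambda>k. e k < l - y) sequentially"
      using e by (intro order_tendstoD(2)) auto
    then show "eventually (\<lambda>k. y < a k) sequentially"
      using eventually_ge_at_top[of 2]
    proof eventually_elim
      case (elim k)
      have "l \<le> a k + e k"
        unfolding l_def using elim(2) by (intro cINF_lower bdd) simp
      then show ?case
        using elim(1) by simp
    qed
  next
    fix y assume y: "l < y"
    then obtain k where k: "k \<ge> 2" "a k + e k < y"
      using cINF_less_iff[OF _ bdd, of y] unfolding l_def by auto
    obtain z where z: "a k + e k < z" "z < y"
      using dense[OF k(2)] by blast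
    then have "z - (a k + e k) > 0"
      by simp
    from eventually_ln_xi_m'_le[OF k(1) this]
    show "eventually (\<lambda>n. a n < y) sequentially"
    proof eventually_elim
      case (elim n)
      then have "a n \<le> z"
        by (simp add: a_def e_def)
      then show ?case
        using z(2) by simp
    qed
  qed
  then show ?thesis
    unfolding a_def by blast
qed

end
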